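(* Let $H$ be an infinite Heyting algebra, and let $C = \{x\in H : x\vee\neg x = \top\}$ and $D = \{x \in H : x \vee \neg x \neq \top\}$. Then either $|D| = 0$ or $|C| \leq |D|$ (as cardinals).
   Context: $\neg x$ abbreviates $x \to \bot$. *)

theory Defs
  imports Main
begin

unbundle cardinal_syntax

class heyting_algebra = bounded_lattice +
  fixes himp :: "'a \<Rightarrow> 'a \<Rightarrow> 'a"
  assumes himp_residuated: "inf x a \<le> b \<longleftrightarrow> x \<le> himp a b"
begin

definition hneg :: "'a \<Rightarrow> 'a"
  where "hneg x = himp x bot"

end

end

theory Submission
  imports Defs
begin

text \<open>
  If \<open>D\<close> is nonempty it contains a dense element \<open>d = x \<squnion> \<not>x\<close>, and by density
  \<open>c \<mapsto> c \<sqinter> d\<close> is injective on the Boolean subalgebra \<open>C\<close>. Since \<open>C\<close> is closed under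
  joins and \<open>d = (c \<sqinter> d) \<squnion> (\<not>c \<sqinter> d)\<close>, one of \<open>c \<sqinter> d\<close> and \<open>\<not>c \<sqinter> d\<close> lies in \<open>D\<close>.
  Hence \<open>C\<close> is covered by two sets of cardinality at most \<open>|D|\<close>, and \<open>D\<close> is infinite.
\<close>

context heyting_algebra
begin

text \<open>Meeting with \<open>a\<close> has the right adjoint \<open>himp a\<close>, hence
  preserves joins.\<close>

lemma inf_sup_distrib_heyting: "inf a (sup b c) = sup (inf a b) (inf a c)"
proof (rule order.antisym)
  let ?r = "sup (inf a b) (inf a c)"
  have "b \<le> himp a ?r" "c \<le> himp a ?r"
    by (simp_all add: himp_residuated [symmetric] inf.commute)
  then have "sup b c \<le> himp a ?r"
    by simp
  then show "inf a (sup b c) \<le> ?r"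
    by (simp add: himp_residuated [symmetric] inf.commute)
qed (simp add: le_infI2)

lemma le_hneg_iff: "x \<le> hneg a \<longleftrightarrow> inf x a = bot"
  by (metis hneg_def himp_residuated bot_unique)

lemma inf_hneg [simp]: "inf a (hneg a) = bot"
  using le_hneg_iff [of "hneg a" a] by (simp add: inf.commute)

lemma complemented_if_complement:
  assumes "inf a b = bot" and "sup a b = top"
  shows "sup a (hneg a) = top"
proof -
  have "b \<le> hneg a"
    using assms(1) by (simp add: le_hneg_iff inf.commute)
  then show ?thesis
    by (metis assms(2) order.refl sup_mono top_unique)
qed

text \<open>The De Morgan candidate \<open>inf (hneg a) (hneg b)\<close> is a genuine complement of
  the join.\<close>

lemma complemented_sup:
  assumes "sup a (hneg a) = top" and "sup b (hneg b) = top"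
  shows "sup (sup a b) (hneg (sup a b)) = top"
proof (rule complemented_if_complement)
  let ?n = "inf (hneg a) (hneg b)"
  have "inf ?n a = bot" "inf ?n b = bot"
    by (metis inf_hneg inf.assoc inf.commute inf_bot_left)+
  then show "inf (sup a b) ?n = bot"
    by (simp add: inf.commute [of "sup a b"] inf_sup_distrib_heyting)
  \<comment> \<open>Complementedness of \<open>b\<close> splits \<open>hneg a\<close> into a part
    below \<open>hneg b\<close> and a part below \<open>b\<close>.\<close>
  have "hneg a = sup ?n (inf (hneg a) b)"
    by (metis assms(2) inf_sup_distrib_heyting inf_top_right sup.commute)
  also have "\<dots> \<le> sup (sup a b) ?n"
    by (simp add: le_infI2 le_supI1)
  finally show "sup (sup a b) ?n = top"
    by (metis assms(1) order.trans sup.cobounded1 sup.bounded_iff top_unique)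
qed

lemma hneg_hneg_complemented:
  assumes "sup c (hneg c) = top"
  shows "hneg (hneg c) = c"
proof (rule order.antisym)
  have "hneg (hneg c) = inf (hneg (hneg c)) (sup c (hneg c))"
    by (simp add: assms)
  also have "\<dots> = inf (hneg (hneg c)) c"
    by (metis inf_sup_distrib_heyting inf_hneg inf.commute sup_bot_right)
  finally show "hneg (hneg c) \<le> c"
    by (metis inf.cobounded2)
qed (simp add: le_hneg_iff)

text \<open>An element disjoint from \<open>x\<close> lies below \<open>hneg x\<close>; being
  disjoint from \<open>hneg x\<close> too, it is \<open>bot\<close>.\<close>

lemma hneg_sup_hneg: "hneg (sup x (hneg x)) = bot"
proof -
  let ?n = "hneg (sup x (hneg x))"
  have "sup (inf ?n x) (inf ?n (hneg x)) = bot"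
    by (metis inf_hneg inf.commute inf_sup_distrib_heyting)
  then have "?n \<le> hneg x" "inf ?n (hneg x) = bot"
    by (simp_all add: le_hneg_iff)
  then show ?thesis
    by (simp add: inf.absorb1)
qed

text \<open>The difference \<open>inf a (hneg b)\<close> is disjoint from the dense
  \<open>d\<close>, so it vanishes, and splitting \<open>a\<close> along \<open>b\<close> leaves
  only \<open>inf a b\<close>.\<close>

lemma le_if_inf_dense_eq:
  assumes "hneg d = bot" and "sup b (hneg b) = top" and "inf a d = inf b d"
  shows "a \<le> b"
proof -
  have "inf (inf a (hneg b)) d = bot"
    by (metis assms(3) inf_hneg inf.assoc inf.commute inf_bot_left)
  then have "inf a (hneg b) = bot"
    using assms(1) le_hneg_iff bot_unique by metis
  then have "a = inf a b"
    by (metis assms(2) inf_sup_distrib_heyting inf_top_right sup_bot_right)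
  then show ?thesis
    by (metis inf.cobounded2)
qed

lemma inj_on_inf_dense:
  assumes "hneg d = bot"
  shows "inj_on (\<lambda>c. inf c d) {c. sup c (hneg c) = top}"
proof (rule inj_onI)
  fix a b
  assume "a \<in> {c. sup c (hneg c) = top}" "b \<in> {c. sup c (hneg c) = top}"
    and "inf a d = inf b d"
  then show "a = b"
    using le_if_inf_dense_eq [OF assms, of a b] le_if_inf_dense_eq [OF assms, of b a]
    by (simp add: order.antisym)
qed

text \<open>Were both pieces complemented, their join, which is \<open>d\<close>, would be
  too.\<close>

lemma not_complemented_inf_cases:
  assumes "sup d (hneg d) \<noteq> top" and "sup c (hneg c) = top"
  shows "sup (inf c d) (hneg (inf c d)) \<noteq> top
    \<or> sup (inf (hneg c) d) (hneg (inf (hneg c) d)) \<noteq> top"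
proof -
  have "d = sup (inf c d) (inf (hneg c) d)"
    by (metis assms(2) inf.commute inf_sup_distrib_heyting inf_top_right)
  then show ?thesis
    using complemented_sup assms(1) by metis
qed

end

theorem theorem4p11:
  fixes C D :: "'a::heyting_algebra set"
  assumes inf_H: "infinite (UNIV :: 'a set)"
    and C_def: "C = {x. sup x (hneg x) = top}"
    and D_def: "D = {x. sup x (hneg x) \<noteq> top}"
  shows "|D| =o (czero :: 'a rel) \<or> |C| \<le>o |D|"
proof (cases "D = {}")
  case True
  then show ?thesis
    by (simp add: czero_def card_of_refl)
next
  case False
  then obtain x :: 'a where x: "sup x (hneg x) \<noteq> top"
    by (auto simp: D_def)
  define d where "d = sup x (hneg x)"
  have dense: "hneg d = bot"
    by (simp add: d_def hneg_sup_hneg)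
  \<comment> \<open>Since \<open>hneg d\<close> is \<open>bot\<close>, this join is just
    \<open>d\<close>, which is not \<open>top\<close> by the choice of \<open>x\<close>.\<close>
  then have d: "sup d (hneg d) \<noteq> top"
    using x by (simp add: d_def)
  define A where "A = {c \<in> C. inf c d \<in> D}"
  have "inj_on (\<lambda>c. inf c d) A"
    by (rule inj_on_subset [OF inj_on_inf_dense [OF dense]]) (auto simp: A_def C_def)
  then have A: "|A| \<le>o |D|"
    by (intro card_of_ordLeqI) (auto simp: A_def)
  have A': "|hneg ` A| \<le>o |D|"
    by (rule ordLeq_transitive [OF card_of_image A])
  \<comment> \<open>If \<open>c\<close> is not in \<open>A\<close> then \<open>hneg c\<close> is,
    and \<open>c\<close> is recovered as its negation.\<close>
  have cover: "C \<subseteq> A \<union> hneg ` A"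
  proof
    fix c
    assume "c \<in> C"
    then have c: "sup c (hneg c) = top"
      by (simp add: C_def)
    note dn = hneg_hneg_complemented [OF c]
    then have "hneg c \<in> C"
      using c by (simp add: C_def sup.commute)
    then have "c \<in> A \<or> hneg c \<in> A"
      using not_complemented_inf_cases [OF d c] \<open>c \<in> C\<close> by (auto simp: A_def D_def)
    then show "c \<in> A \<union> hneg ` A"
      using dn imageI [of "hneg c" A hneg] by auto
  qed
  \<comment> \<open>Bounding the union of two sets by \<open>|D|\<close> requires \<open>D\<close>
    infinite; a finite \<open>D\<close> would make \<open>C\<close>, and so the whole algebra,
    finite.\<close>
  have "infinite D"
  proof
    assume "finite D"
    then have "finite A" "finite (hneg ` A)"
      using A A' card_of_ordLeq_finite by blast+
    then have "finite C"
      using cover finite_subset by blast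
    moreover have "C \<union> D = UNIV"
      by (auto simp: C_def D_def)
    ultimately show False
      using \<open>finite D\<close> inf_H finite_UnI [of C D] by simp
  qed
  then have "|A \<union> hneg ` A| \<le>o |D|"
    using A A' by (intro card_of_Un_ordLeq_infinite_Field) (simp_all add: Field_card_of card_of_card_order_on)
  then have "|C| \<le>o |D|"
    by (rule ordLeq_transitive [OF card_of_mono1 [OF cover]])
  then show ?thesis ..
qed

end
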